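(* For all 4-tuples $A,B,C\in V^4$, where $V=\{\text{marked},\text{unmarked}\}$, $$(A\wedge_k B)\wedge_j C=(A\wedge_j C)\wedge_k (B\wedge_j C),$$ where $\wedge_j$ and $\wedge_k$ are the binary operations on $V^4$ $$A\wedge_j B = J^3\big(J(A)\cdot J(B)\big),\qquad A\wedge_k B = K^3\big(K(A)\cdot K(B)\big),$$ with $J(a,b,c,d)=(\bar{c},\bar{d},a,b)$, $K(a,b,c,d)=(\bar{d},c,\bar{b},a)$, and $\cdot$ denoting componentwise juxtaposition.
   Context: In Laws of Form (LoF) an expression takes one of two values, marked or unmarked. Crossing $x\mapsto\bar{x}$ interchanges the two values. Juxtaposition $xy$ of $x,y\in V$ is marked if at least one of $x,y$ is marked and unmarked otherwise (i.e. it is Boolean "or" with marked read as true). On 4-tuples, juxtaposition is componentwise: $(a,b,c,d)\cdot(e,f,g,h)=(ae,bf,cg,dh)$. Powers such as $J^3$ denote iterated composition of the operator with itself. *)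

theory Defs
  imports Main
begin

datatype lof_val = Marked | Unmarked

type_synonym lof_quad = "lof_val \<times> lof_val \<times> lof_val \<times> lof_val"

fun cross :: "lof_val \<Rightarrow> lof_val" where
  "cross Marked = Unmarked"
| "cross Unmarked = Marked"

definition juxt :: "lof_val \<Rightarrow> lof_val \<Rightarrow> lof_val" where
  "juxt x y = (if x = Marked \<or> y = Marked then Marked else Unmarked)"

fun quad_juxt :: "lof_quad \<Rightarrow> lof_quad \<Rightarrow> lof_quad" (infixl "\<cdot>" 70) where
  "(a, b, c, d) \<cdot> (e, f, g, h) = (juxt a e, juxt b f, juxt c g, juxt d h)"

fun J :: "lof_quad \<Rightarrow> lof_quad" where
  "J (a, b, c, d) = (cross c, cross d, a, b)"

fun K :: "lof_quad \<Rightarrow> lof_quad" where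
  "K (a, b, c, d) = (cross d, c, cross b, a)"

definition wedge_j :: "lof_quad \<Rightarrow> lof_quad \<Rightarrow> lof_quad" (infix "\<and>\<^sub>j" 65) where
  "A \<and>\<^sub>j B = (J ^^ 3) (J A \<cdot> J B)"

definition wedge_k :: "lof_quad \<Rightarrow> lof_quad \<Rightarrow> lof_quad" (infix "\<and>\<^sub>k" 65) where
  "A \<and>\<^sub>k B = (K ^^ 3) (K A \<cdot> K B)"

end

(* Each of J^3 and K^3 inverts the operator it comes from, so conjugating juxtaposition ("or") by J
   or K gives an operation that is "or" in some coordinates and, by De Morgan, "and" in the others.
   The theorem is then coordinatewise distributivity in a Boolean algebra. *)

theory Submission
  imports Defs
begin

definition meet :: "lof_val \<Rightarrow> lof_val \<Rightarrow> lof_val" where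
  "meet x y = cross (juxt (cross x) (cross y))"

lemma cross_cross [simp]: "cross (cross x) = x"
  by (cases x) simp_all

text \<open>\<open>J\<close> crosses exactly the entries \<open>c\<close> and \<open>d\<close> of
  its argument, so these become \<open>meet\<close>; for \<open>K\<close> below they are
  \<open>b\<close> and \<open>d\<close>.\<close>

lemma wedge_j_coords:
  "(a, b, c, d) \<and>\<^sub>j (e, f, g, h) = (juxt a e, juxt b f, meet c g, meet d h)"
  by (simp add: wedge_j_def meet_def numeral_3_eq_3)

lemma wedge_k_coords:
  "(a, b, c, d) \<and>\<^sub>k (e, f, g, h) = (juxt a e, meet b f, juxt c g, meet d h)"
  by (simp add: wedge_k_def meet_def numeral_3_eq_3)

text \<open>Idempotence absorbs the second \<open>z\<close>. The four coordinates realise all four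
  pairings of "or" and "and", hence four laws.\<close>

lemma juxt_juxt_distrib: "juxt (juxt x y) z = juxt (juxt x z) (juxt y z)"
  by (simp add: juxt_def)

lemma meet_meet_distrib: "meet (meet x y) z = meet (meet x z) (meet y z)"
  by (simp add: meet_def flip: juxt_juxt_distrib)

lemma juxt_meet_distrib: "juxt (meet x y) z = meet (juxt x z) (juxt y z)"
  by (cases x; cases y; cases z) (simp_all add: juxt_def meet_def)

lemma meet_juxt_distrib: "meet (juxt x y) z = juxt (meet x z) (meet y z)"
  by (cases x; cases y; cases z) (simp_all add: juxt_def meet_def)

theorem mainTheorem4:
  fixes A B C :: lof_quad
  shows "(A \<and>\<^sub>k B) \<and>\<^sub>j C = (A \<and>\<^sub>j C) \<and>\<^sub>k (B \<and>\<^sub>j C)"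
  \<comment> \<open>The laws are used right to left, merging the two copies of \<open>C\<close>:
    read forwards, the two self-distributive ones would rewrite forever.\<close>
  by (cases A; cases B; cases C)
    (simp only: wedge_j_coords wedge_k_coords prod.inject
      juxt_juxt_distrib [symmetric] meet_meet_distrib [symmetric]
      juxt_meet_distrib [symmetric] meet_juxt_distrib [symmetric])

end
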